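(* For $n\ge 1$, \begin{eqnarray*} & & \phi_{0\rightarrow (n+1)} = \phi_{0\rightarrow1}\prod_{j=1}^{n}\phi_{j\rightarrow(j+1)\mid\text{before }(j-1)}\, \left( \sum_{k\geq 0} \sum_{**}\prod_{t=1}^k L_{i_t}\right)\\[0.2cm] & & = \phi_{0\rightarrow1}\prod_{j=1}^{n}\phi_{j\rightarrow(j+1)\mid\text{before }(j-1)}\, \sum_{k\geq 0} \left((L_1+L_2+\cdots + L_n)+\sum_{*'} (-1)^{l+1} (L_{j_1}L_{j_2}\cdots L_{j_l}) \right)^k\\[0.2cm] & & = \phi_{0\rightarrow1}\prod_{j=1}^{n}\phi_{j\rightarrow(j+1)\mid\text{before }(j-1)}\, \frac{1}{1-(L_1+L_2+\cdots + L_n)+\sum\limits_{*'}(-1)^{l} (L_{j_1}L_{j_2}\cdots L_{j_l})}, \end{eqnarray*} where \[ **=\{(i_1,i_2,\cdots, i_k): 1 \leq i_t \leq n, \text{and } i_t = i_{t+1}, i_t =i_{t+1}+1, \text{or } i_t < i_{t+1}\}; \] and \[ *'=\{n\geq j_{1} > \cdots >j_{l}\ge 1,\; l \geq 2, \; j_{m}-j_{m+1}\ge2\}. \]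
   Context: A walk moves only between consecutive sites $a_0<a_1<\cdots<a_{n+1}$, starting at $a_0$, with no sites to the left of $a_0$ (so from $a_0$ it can only go to $a_1$). For sites indexed $m,n,k$: $\phi_{m\rightarrow n}$ is the moment generating function of the hitting time of the $n$th site starting from the $m$th site, and $\phi_{m\rightarrow n\mid\text{before }k}$ is the moment generating function of the hitting time of the $n$th site starting from the $m$th site before hitting the $k$th site (successive pieces of the path are independent). The loop between consecutive sites $n-1$ and $n$ has moment generating function $L_n=\phi_{(n-1)\rightarrow n\mid\text{before }(n-2)}\cdot\phi_{n\rightarrow(n-1)\mid\text{before }(n+1)}$ (for $n=1$ the first factor is $\phi_{0\rightarrow1}$). *)

theory Defs
  imports "HOL-Probability.Probability"
begin

text \<open>
  The site \<open>a\<^sub>j\<close> is represented by its index \<open>j\<close>. \<open>P m\<close> is the law of the walk started at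
  site \<open>m\<close>, \<open>S k\<close> the site occupied after \<open>k\<close> moves and \<open>D k\<close> the time taken by the move from
  \<open>S k\<close> to \<open>S (Suc k)\<close>, whose law may be arbitrary. (For a process with continuous paths, \<open>S\<close>
  lists the successive distinct sites visited.) \<open>K j\<close> is the joint law of the next site and of the
  time needed to get there, for a move that starts at \<open>j\<close>; the direction and the duration of a move
  may be dependent. The last assumption gives the finite-dimensional distributions: the walk
  starts at \<open>m\<close> and, given the sites visited, successive pieces of the path are independent.

  The walk is nearest-neighbour on the sites \<open>0, \<dots>, n\<close> (so from 0 it goes to 1); its
  behaviour after it has reached \<open>n + 1\<close> is left free, as the identities do not depend on it.
\<close>

locale site_walk =
  fixes n :: nat
    and P :: "nat \<Rightarrow> 'w measure"
    and S :: "nat \<Rightarrow> 'w \<Rightarrow> nat"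
    and D :: "nat \<Rightarrow> 'w \<Rightarrow> real"
    and K :: "nat \<Rightarrow> (nat \<times> real) measure"
  assumes prob_space_P: "\<And>m. prob_space (P m)"
    and measurable_S: "\<And>m k. S k \<in> measurable (P m) (count_space UNIV)"
    and measurable_D: "\<And>m k. D k \<in> borel_measurable (P m)"
    and prob_space_K: "\<And>j. prob_space (K j)"
    and sets_K: "\<And>j. sets (K j) = sets (count_space UNIV \<Otimes>\<^sub>M borel)"
    and duration_pos: "\<And>j. AE y in K j. 0 < snd y"
    and nearest_neighbour: "\<And>j. j \<le> n \<Longrightarrow> AE y in K j. fst y = j + 1 \<or> fst y + 1 = j"
    and independent_pieces: "\<And>m k x B. (\<And>i. i < k \<Longrightarrow> B i \<in> sets borel) \<Longrightarrow>
      measure (P m) {w \<in> space (P m). S k w = x k \<and> (\<forall>i<k. S i w = x i \<and> D i w \<in> B i)} =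
        of_bool (x 0 = m) * (\<Prod>i<k. measure (K (x i)) ({x (Suc i)} \<times> B i))"

text \<open>The infimum is \<open>\<infinity>\<close> if site \<open>a\<close> is never visited.\<close>

definition hit_time :: "(nat \<Rightarrow> 'w \<Rightarrow> nat) \<Rightarrow> (nat \<Rightarrow> 'w \<Rightarrow> real) \<Rightarrow> nat \<Rightarrow> 'w \<Rightarrow> ereal" where
  "hit_time S D a w = Inf {ereal (\<Sum>i<k. D i w) | k. S k w = a}"

text \<open>
  Moment generating functions at the real argument \<open>s\<close>, in the usual unnormalised form for
  possibly infinite times: \<open>E\<^sub>m[exp (s T\<^sub>a); T\<^sub>a < \<infinity>]\<close> and \<open>E\<^sub>m[exp (s T\<^sub>a); T\<^sub>a < T\<^sub>b]\<close>. Thus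
  ``before \<open>b\<close>'' is a restriction to an event, not a conditioning on it.
\<close>

definition hit_exp :: "(nat \<Rightarrow> 'w \<Rightarrow> nat) \<Rightarrow> (nat \<Rightarrow> 'w \<Rightarrow> real) \<Rightarrow> real \<Rightarrow> nat \<Rightarrow> 'w \<Rightarrow> real" where
  "hit_exp S D s a w =
     (if hit_time S D a w < \<infinity> then exp (s * real_of_ereal (hit_time S D a w)) else 0)"

definition hit_mgf ::
  "(nat \<Rightarrow> 'w measure) \<Rightarrow> (nat \<Rightarrow> 'w \<Rightarrow> nat) \<Rightarrow> (nat \<Rightarrow> 'w \<Rightarrow> real) \<Rightarrow> real \<Rightarrow> nat \<Rightarrow> nat \<Rightarrow> real" where
  "hit_mgf P S D s m a = (\<integral>w. hit_exp S D s a w \<partial>P m)"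

definition hit_mgf_before ::
  "(nat \<Rightarrow> 'w measure) \<Rightarrow> (nat \<Rightarrow> 'w \<Rightarrow> nat) \<Rightarrow> (nat \<Rightarrow> 'w \<Rightarrow> real) \<Rightarrow> real \<Rightarrow> nat \<Rightarrow> nat \<Rightarrow> nat \<Rightarrow> real" where
  "hit_mgf_before P S D s m a b =
     (\<integral>w. (if hit_time S D a w < hit_time S D b w then hit_exp S D s a w else 0) \<partial>P m)"

text \<open>\<open>loop_mgf P S D s j\<close> is the loop between \<open>j - 1\<close> and \<open>j\<close>, meant for \<open>j \<ge> 1\<close>.\<close>

definition loop_mgf ::
  "(nat \<Rightarrow> 'w measure) \<Rightarrow> (nat \<Rightarrow> 'w \<Rightarrow> nat) \<Rightarrow> (nat \<Rightarrow> 'w \<Rightarrow> real) \<Rightarrow> real \<Rightarrow> nat \<Rightarrow> real" where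
  "loop_mgf P S D s j =
     (if j = 1 then hit_mgf P S D s 0 1 else hit_mgf_before P S D s (j - 1) j (j - 2)) *
     hit_mgf_before P S D s j (j - 1) (j + 1)"

text \<open>
  The index sets \<open>**\<close> (for a fixed \<open>k\<close>) and \<open>*'\<close>. Tuples are lists, so the entry written
  with index \<open>t\<close> in \<open>1, \<dots>, k\<close> on paper is \<open>is ! (t - 1)\<close>.
\<close>

definition loop_seqs :: "nat \<Rightarrow> nat \<Rightarrow> nat list set" where
  "loop_seqs n k = {is. length is = k \<and> (\<forall>t<k. 1 \<le> is ! t \<and> is ! t \<le> n) \<and>
     (\<forall>t. Suc t < k \<longrightarrow>
        is ! t = is ! Suc t \<or> is ! t = is ! Suc t + 1 \<or> is ! t < is ! Suc t)}"

definition separated_seqs :: "nat \<Rightarrow> nat list set" where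
  "separated_seqs n = {js. 2 \<le> length js \<and> (\<forall>m<length js. 1 \<le> js ! m \<and> js ! m \<le> n) \<and>
     (\<forall>m. Suc m < length js \<longrightarrow> js ! m \<ge> js ! Suc m + 2)}"

end

theory Submission
  imports Defs
begin

text \<open>
  Let \<open>D\<^sub>j\<close> be the continuant given by \<open>D\<^sub>j = D\<^sub>j\<^sub>-\<^sub>1 - L\<^sub>j D\<^sub>j\<^sub>-\<^sub>2\<close> and \<open>D\<^sub>0 = D\<^sub>-\<^sub>1 = 1\<close>; expanding the recursion
  gives the alternating sum over separated tuples, so that \<open>D\<^sub>n\<close> is the denominator of the theorem.
  Both remaining expressions satisfy the same three-term recursion. With \<open>p\<^sub>j\<close>, \<open>q\<^sub>j\<close> the generating
  functions of one move up or down and \<open>f\<^sub>j\<close> that of the passage from \<open>j\<close> to \<open>n + 1\<close>, the first-step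
  equation \<open>f\<^sub>j = p\<^sub>j f\<^sub>j\<^sub>+\<^sub>1 + q\<^sub>j f\<^sub>j\<^sub>-\<^sub>1\<close> turns into \<open>p\<^sub>0 \<cdots> p\<^sub>j f\<^sub>j\<^sub>+\<^sub>1 = D\<^sub>j f\<^sub>0\<close>, hence \<open>A = D\<^sub>n f\<^sub>0\<close> and all
  \<open>D\<^sub>j\<close> are positive. If \<open>u\<^sub>i\<close> sums the loop words that are empty or start with a letter \<open>\<ge> i\<close>,
  removal of the first letter gives \<open>u\<^sub>i = 1 + (\<Sum>j\<ge>i. L\<^sub>j u\<^sub>j\<^sub>-\<^sub>1)\<close>, hence \<open>D\<^sub>n u\<^sub>0 = 1\<close>; positivity
  of the \<open>D\<^sub>j\<close> makes \<open>D\<^sub>i\<^sub>-\<^sub>1 / D\<^sub>n\<close> an upper bound for the partial sums. Finally \<open>1 \<le> u\<^sub>0\<close> puts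
  \<open>1 - D\<^sub>n\<close> into \<open>[0, 1)\<close>, so the geometric series converges. When some \<open>p\<^sub>j\<close> vanishes, so do
  \<open>A\<close> and \<open>f\<^sub>0\<close>.
\<close>

subsection \<open>Continuants and words of loops\<close>

text \<open>Determinant of the tridiagonal matrix of size n + 1 with ones on the diagonal, whose
  mirrored off-diagonal entries have the products L_1, ..., L_n. The second equation is the
  recursion with the value 1 at index -1.\<close>

fun continuant :: "(nat \<Rightarrow> real) \<Rightarrow> nat \<Rightarrow> real" where
  "continuant L 0 = 1"
| "continuant L (Suc 0) = 1 - L 1"
| "continuant L (Suc (Suc n)) = continuant L (Suc n) - L (Suc (Suc n)) * continuant L n"

text \<open>A three-term recursion is determined by two starting values. Indices are shifted by one
  so that \<open>u 0\<close> can play the role of D_{-1}; this serves both for sums over loop words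
  and for first-passage functions.\<close>

lemma continuant_unique:
  fixes u L :: "nat \<Rightarrow> real"
  assumes u: "u 0 = c" "u 1 = c"
    and rec: "\<And>i. 1 \<le> i \<Longrightarrow> i \<le> n \<Longrightarrow> u (Suc i) = u i - L i * u (i - 1)"
    and "i \<le> n"
  shows "u (Suc i) = continuant L i * c"
  using \<open>i \<le> n\<close>
proof (induction i rule: induct_nat_012)
  case 0
  then show ?case using u by simp
next
  case 1
  then show ?case using u rec[of 1] by (simp add: left_diff_distrib)
next
  case (ge2 i)
  then show ?case using rec[of "Suc (Suc i)"] by (simp add: left_diff_distrib)
qed

section \<open>Separated tuples and the expansion of the continuant\<close>

definition gap_seqs :: "nat \<Rightarrow> nat list set" where
  "gap_seqs n = {js. set js \<subseteq> {1..n} \<and> successively (\<lambda>i j. i \<ge> j + 2) js}"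

lemma gap_seqs_Cons:
  "j # js \<in> gap_seqs n \<longleftrightarrow> 1 \<le> j \<and> j \<le> n \<and> js \<in> gap_seqs n \<and> (js = [] \<or> j \<ge> hd js + 2)"
  by (auto simp: gap_seqs_def successively_Cons)

text \<open>The entries decrease, so a bound on the head bounds all of them.\<close>

lemma gap_seqs_hd_max: "js \<in> gap_seqs n \<Longrightarrow> js = [] \<or> hd js \<le> m \<Longrightarrow> js \<in> gap_seqs m"
proof (induction js)
  case Nil
  then show ?case by (simp add: gap_seqs_def)
next
  case (Cons j js)
  then show ?case by (auto simp: gap_seqs_Cons)
qed

lemma gap_seqs_mono: "m \<le> n \<Longrightarrow> gap_seqs m \<subseteq> gap_seqs n"
  unfolding gap_seqs_def by fastforce

lemma gap_seqs_hd_le: "js \<in> gap_seqs n \<Longrightarrow> js \<noteq> [] \<Longrightarrow> hd js \<le> n"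
  by (cases js) (auto simp: gap_seqs_Cons)

lemma Nil_gap_seqs: "[] \<in> gap_seqs n"
  by (simp add: gap_seqs_def)

lemma gap_seqs_0: "gap_seqs 0 = {[]}"
  by (auto simp: gap_seqs_def)

lemma gap_seqs_1: "gap_seqs (Suc 0) = {[], [1]}"
proof -
  have "js \<in> gap_seqs (Suc 0) \<Longrightarrow> js \<in> {[], [1]}" for js
    using gap_seqs_hd_le[of "tl js" "Suc 0"] by (cases js) (auto simp: gap_seqs_Cons)
  then show ?thesis by (auto simp: gap_seqs_Cons Nil_gap_seqs)
qed

text \<open>Split by whether n + 2 occurs: if it does, it is the head, and the gap condition
  confines the remaining entries to 1, ..., n. This is the combinatorial form of the recursion for
  the continuant.\<close>

lemma gap_seqs_Suc_Suc:
  "gap_seqs (Suc (Suc n)) = gap_seqs (Suc n) \<union> (#) (Suc (Suc n)) ` gap_seqs n"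
proof (intro equalityI subsetI)
  fix js assume js: "js \<in> gap_seqs (Suc (Suc n))"
  show "js \<in> gap_seqs (Suc n) \<union> (#) (Suc (Suc n)) ` gap_seqs n"
  proof (cases "js = [] \<or> hd js \<le> Suc n")
    case True
    then show ?thesis using js gap_seqs_hd_max by blast
  next
    case False
    then obtain ks where "js = Suc (Suc n) # ks"
      using js gap_seqs_hd_le[OF js] by (cases js) auto
    then show ?thesis using js gap_seqs_hd_max[of ks] by (auto simp: gap_seqs_Cons)
  qed
next
  fix js assume "js \<in> gap_seqs (Suc n) \<union> (#) (Suc (Suc n)) ` gap_seqs n"
  then consider "js \<in> gap_seqs (Suc n)"
    | ks where "js = Suc (Suc n) # ks" "ks \<in> gap_seqs n" by blast
  then show "js \<in> gap_seqs (Suc (Suc n))"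
  proof cases
    case 1
    then show ?thesis using gap_seqs_mono[of "Suc n" "Suc (Suc n)"] by auto
  next
    case 2
    moreover have "ks \<in> gap_seqs (Suc (Suc n))"
      using 2(2) gap_seqs_mono[of n "Suc (Suc n)"] by auto
    ultimately show ?thesis using gap_seqs_hd_le[of ks n] by (auto simp: gap_seqs_Cons)
  qed
qed

lemma finite_gap_seqs: "finite (gap_seqs n)"
  by (induction n rule: induct_nat_012)
    (auto simp: gap_seqs_0 gap_seqs_1 gap_seqs_Suc_Suc)

lemma sum_gap_seqs:
  "(\<Sum>js\<in>gap_seqs n. (-1) ^ length js * (\<Prod>m<length js. L (js ! m))) = continuant L n"
proof (induction L n rule: continuant.induct)
  case (3 L n)
  let ?g = "\<lambda>js. (-1) ^ length js * (\<Prod>m<length js. L (js ! m))"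
  have disj: "gap_seqs (Suc n) \<inter> (#) (Suc (Suc n)) ` gap_seqs n = {}"
    by (auto simp: gap_seqs_Cons)
  have "(\<Sum>js\<in>(#) (Suc (Suc n)) ` gap_seqs n. ?g js) = (\<Sum>js\<in>gap_seqs n. ?g (Suc (Suc n) # js))"
    by (subst sum.reindex) auto
  \<comment> \<open>Prepending n + 2 contributes one sign and one factor
    \<open>L (n + 2)\<close>.\<close>
  also have "\<dots> = - L (Suc (Suc n)) * (\<Sum>js\<in>gap_seqs n. ?g js)"
    unfolding sum_distrib_left
    by (intro sum.cong refl) (simp add: prod.lessThan_Suc_shift del: prod.lessThan_Suc)
  finally show ?case
    unfolding gap_seqs_Suc_Suc using 3 disj
    by (subst sum.union_disjoint) (auto simp: finite_gap_seqs)
qed (simp_all add: gap_seqs_0 gap_seqs_1)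

text \<open>\<open>gap_seqs\<close> has no lower bound on the length: the empty tuple contributes 1,
  the singletons contribute the terms -L_j, and all longer tuples are separated in the sense of the
  theorem.\<close>

lemma sum_separated_seqs:
  "1 - (\<Sum>j=1..n. L j) + (\<Sum>js\<in>separated_seqs n. (-1) ^ length js * (\<Prod>m<length js. L (js ! m)))
     = continuant L n"
proof -
  let ?g = "\<lambda>js. (-1) ^ length js * (\<Prod>m<length js. L (js ! m))"
  have sep: "separated_seqs n = {js \<in> gap_seqs n. 2 \<le> length js}"
    unfolding separated_seqs_def gap_seqs_def successively_conv_nth
    by (auto simp: set_conv_nth)
  have "js \<in> insert [] ((\<lambda>j. [j]) ` {1..n})" if "js \<in> gap_seqs n" "\<not> 2 \<le> length js" for js
    using that by (cases js rule: list.exhaust; cases "tl js") (auto simp: gap_seqs_Cons)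
  then have split: "gap_seqs n = insert [] ((\<lambda>j. [j]) ` {1..n}) \<union> separated_seqs n"
    unfolding sep by (auto simp: gap_seqs_Cons Nil_gap_seqs)
  have "(\<Sum>js\<in>gap_seqs n. ?g js)
      = (\<Sum>js\<in>insert [] ((\<lambda>j. [j]) ` {1..n}). ?g js) + (\<Sum>js\<in>separated_seqs n. ?g js)"
    unfolding split
    by (rule sum.union_disjoint) (auto simp: sep finite_gap_seqs)
  also have "(\<Sum>js\<in>insert [] ((\<lambda>j. [j]) ` {1..n}). ?g js) = 1 - (\<Sum>j=1..n. L j)"
    by (subst sum.insert) (auto simp: sum.reindex inj_on_def sum_negf)
  finally show ?thesis by (simp add: sum_gap_seqs)
qed

section \<open>Loop words and the sum of their weights\<close>

definition loop_seqs_from :: "nat \<Rightarrow> nat \<Rightarrow> nat \<Rightarrow> nat list set" where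
  "loop_seqs_from n k i = {is \<in> loop_seqs n k. is = [] \<or> i \<le> hd is}"

lemma loop_seqs_from_0: "loop_seqs_from n 0 i = {[]}"
  by (auto simp: loop_seqs_from_def loop_seqs_def)

lemma loop_seqs_altdef:
  "loop_seqs n k = {is. length is = k \<and> set is \<subseteq> {1..n} \<and>
     successively (\<lambda>i j. i = j \<or> i = j + 1 \<or> i < j) is}"
  unfolding loop_seqs_def successively_conv_nth by (auto simp: set_conv_nth)

lemma loop_seqs_from_1:
  assumes "i \<le> 1"
  shows "loop_seqs_from n k i = loop_seqs n k"
proof -
  have "i \<le> hd is" if "is \<in> loop_seqs n k" "is \<noteq> []" for "is"
  proof -
    have "set is \<subseteq> {1..n}" using that by (simp add: loop_seqs_altdef)
    then have "hd is \<in> {1..n}" using that(2) by (metis hd_in_set subsetD)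
    then show ?thesis using assms by simp
  qed
  then show ?thesis by (auto simp: loop_seqs_from_def)
qed

text \<open>The three alternatives for adjacent letters together say only that the letter after j is
  at least j - 1. Hence the lower bound on the first letter is all that must be remembered about a
  word.\<close>

lemma loop_seqs_Cons:
  "j # js \<in> loop_seqs n (Suc k) \<longleftrightarrow> 1 \<le> j \<and> j \<le> n \<and> js \<in> loop_seqs_from n k (j - 1)"
  unfolding loop_seqs_from_def loop_seqs_altdef by (auto simp: successively_Cons)

lemma finite_loop_seqs: "finite (loop_seqs n k)"
  by (rule finite_subset[OF _ finite_lists_length_eq[of "{1..n}" k]]) (auto simp: loop_seqs_altdef)

lemma loop_seqs_from_Suc:
  "loop_seqs_from n (Suc k) i =
     (\<Union>j\<in>{max 1 i..n}. (#) j ` loop_seqs_from n k (j - 1))"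
proof -
  have "is \<in> loop_seqs_from n (Suc k) i \<longleftrightarrow>
      (\<exists>j\<in>{max 1 i..n}. is \<in> (#) j ` loop_seqs_from n k (j - 1))" for "is"
  proof (cases "is")
    case Nil
    then show ?thesis by (auto simp: loop_seqs_from_def loop_seqs_def)
  next
    case (Cons j js)
    then show ?thesis
      using loop_seqs_Cons[of j js n k] by (auto simp: loop_seqs_from_def[of n "Suc k"])
  qed
  then show ?thesis by blast
qed

definition loop_weight :: "(nat \<Rightarrow> real) \<Rightarrow> nat \<Rightarrow> nat \<Rightarrow> nat \<Rightarrow> real" where
  "loop_weight L n k i = (\<Sum>is\<in>loop_seqs_from n k i. \<Prod>t<k. L (is ! t))"

lemma loop_weight_0: "loop_weight L n 0 i = 1"
  by (simp add: loop_weight_def loop_seqs_from_0)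

lemma loop_weight_Suc:
  "loop_weight L n (Suc k) i = (\<Sum>j=max 1 i..n. L j * loop_weight L n k (j - 1))"
proof -
  have fin: "finite (loop_seqs_from n k i)" for k i
    by (simp add: loop_seqs_from_def finite_loop_seqs)
  have "loop_weight L n (Suc k) i =
      (\<Sum>j=max 1 i..n. \<Sum>is\<in>(#) j ` loop_seqs_from n k (j - 1). \<Prod>t<Suc k. L (is ! t))"
    unfolding loop_weight_def loop_seqs_from_Suc
    by (rule sum.UNION_disjoint) (auto simp: fin)
  also have "\<dots> = (\<Sum>j=max 1 i..n. L j * loop_weight L n k (j - 1))"
    unfolding loop_weight_def sum_distrib_left
  proof (rule sum.cong[OF refl])
    fix j
    show "(\<Sum>is\<in>(#) j ` loop_seqs_from n k (j - 1). \<Prod>t<Suc k. L (is ! t)) =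
        (\<Sum>is\<in>loop_seqs_from n k (j - 1). L j * (\<Prod>t<k. L (is ! t)))"
      by (subst sum.reindex) (auto simp: prod.lessThan_Suc_shift simp del: prod.lessThan_Suc)
  qed
  finally show ?thesis .
qed

lemma loop_weight_nonneg:
  assumes "\<And>j. 1 \<le> j \<Longrightarrow> j \<le> n \<Longrightarrow> 0 \<le> L j"
  shows "0 \<le> loop_weight L n k i"
  by (induction k arbitrary: i)
    (auto simp: loop_weight_0 loop_weight_Suc intro!: sum_nonneg mult_nonneg_nonneg assms)

text \<open>Convergence comes first, from an explicit bound that uses positivity of the continuants;
  only then may the first-letter recursion be summed over all lengths, and it identifies the
  limit.\<close>

lemma loop_seqs_sums:
  assumes L: "\<And>j. 1 \<le> j \<Longrightarrow> j \<le> n \<Longrightarrow> 0 \<le> L j"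
    and D: "\<And>j. j \<le> n \<Longrightarrow> 0 < continuant L j"
  shows "(\<lambda>k. \<Sum>is\<in>loop_seqs n k. \<Prod>t<k. L (is ! t)) sums (1 / continuant L n)"
proof -
  let ?D = "continuant L" and ?w = "loop_weight L n"
  \<comment> \<open>With D_{-1} = 1 this is D_{i-1} / D_n, the expected sum over words that are
    empty or start with a letter at least i. It equals 1 at i = n + 1, where only the empty word is
    left.\<close>
  define U where "U i = (if i = 0 then 1 else ?D (i - 1)) / ?D n" for i
  have U_pos: "0 \<le> U i" if "i \<le> Suc n" for i
    using D[of "i - 1"] D[of n] that by (auto simp: U_def intro!: divide_nonneg_pos less_imp_le)
  have U_rec: "U j - U (Suc j) = L j * U (j - 1)" if "1 \<le> j" for j
  proof -
    show ?thesis
    proof (cases "j = 1")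
      case False
      define i where "i = j - 2"
      have "j = Suc (Suc i)" using that False by (simp add: i_def)
      then show ?thesis by (simp add: U_def diff_divide_distrib[symmetric])
    qed (simp add: U_def diff_divide_distrib[symmetric])
  qed
  have U_sum: "(\<Sum>j=max 1 i..n. L j * U (j - 1)) = U (max 1 i) - 1" if "i \<le> Suc n" for i
  proof -
    have "(\<Sum>j=max 1 i..n. L j * U (j - 1)) = (\<Sum>j=max 1 i..n. U j - U (Suc j))"
      using U_rec by (intro sum.cong) auto
    also have "\<dots> = U (max 1 i) - U (Suc n)"
      using that sum_Suc_diff[of "max 1 i" n "\<lambda>j. - U j"] by simp
    finally show ?thesis using D[of n] by (simp add: U_def)
  qed
  have U_max: "U (max 1 i) = U i" for i
    by (cases "i = 0") (auto simp: U_def max_def)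
  \<comment> \<open>The partial sums arise from 0 by iterating the map v -> 1 + (sum over j of L_j
    v_{j-1}), which is monotone since L is nonnegative. \<open>U\<close> is a nonnegative fixed
    point, so the iterates stay below it.\<close>
  have bound: "(\<Sum>l<k. ?w l i) \<le> U i" if "i \<le> Suc n" for k i
    using that
  proof (induction k arbitrary: i)
    case 0
    then show ?case using U_pos by simp
  next
    case (Suc k)
    have "(\<Sum>l<Suc k. ?w l i) = 1 + (\<Sum>j=max 1 i..n. L j * (\<Sum>l<k. ?w l (j - 1)))"
      unfolding sum.lessThan_Suc_shift loop_weight_0 loop_weight_Suc sum_distrib_left
      by (subst sum.swap) simp
    also have "\<dots> \<le> 1 + (\<Sum>j=max 1 i..n. L j * U (j - 1))"
      using Suc by (intro add_left_mono sum_mono mult_left_mono Suc.IH) (auto intro: L)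
    also have "\<dots> = U i" using U_sum Suc.prems U_max by simp
    finally show ?case .
  qed
  have summ: "summable (\<lambda>k. ?w k i)" if "i \<le> Suc n" for i
    using bound[OF that] by (intro summableI_nonneg_bounded[where x="U i"] loop_weight_nonneg L)
  define u where "u i = (\<Sum>k. ?w k i)" for i
  have u_eq: "u i = 1 + (\<Sum>j=max 1 i..n. L j * u (j - 1))" if "i \<le> Suc n" for i
  proof -
    have "u i = 1 + (\<Sum>k. ?w (Suc k) i)"
      using suminf_split_head[OF summ[OF that]] by (simp add: u_def loop_weight_0)
    also have "(\<Sum>k. ?w (Suc k) i) = (\<Sum>j=max 1 i..n. \<Sum>k. L j * ?w k (j - 1))"
      unfolding loop_weight_Suc by (rule suminf_sum) (auto intro!: summable_mult summ)
    also have "\<dots> = (\<Sum>j=max 1 i..n. L j * u (j - 1))"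
      unfolding u_def by (intro sum.cong refl suminf_mult summ) auto
    finally show ?thesis .
  qed
  \<comment> \<open>The sums given by \<open>u_eq\<close> for i and i + 1 differ only in the term
    with index i.\<close>
  have step: "u (Suc i) = u i - L i * u (i - 1)" if "1 \<le> i" "i \<le> n" for i
    using that u_eq[of i] u_eq[of "Suc i"] sum.atLeast_Suc_atMost[of i n "\<lambda>j. L j * u (j - 1)"]
    by (simp add: max_def)
  have "u 1 = u 0" using u_eq[of 0] u_eq[of 1] by simp
  then have "u (Suc n) = ?D n * u 0"
    using continuant_unique[OF refl _ step order_refl] by blast
  moreover have "u (Suc n) = 1" by (simp add: u_eq)
  ultimately have "u 0 = 1 / ?D n" using D[of n] by (simp add: field_simps)
  then show ?thesis
    using summable_sums[OF summ[of 0]] unfolding u_def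
    by (simp add: loop_weight_def loop_seqs_from_1)
qed

text \<open>Multiplying \<open>f i\<close> by the product of all \<open>p j\<close> with j < i turns
  the first-step equation into the recursion of the continuant, because the coefficient of the down
  move becomes \<open>p (i - 1) * q i\<close>, which is \<open>L i\<close>. Positivity of
  \<open>p\<close> and \<open>f\<close> then passes to the continuant.\<close>

lemma continuant_first_passage:
  fixes p q f L :: "nat \<Rightarrow> real"
  assumes p: "\<And>j. j \<le> n \<Longrightarrow> 0 < p j"
    and f_pos: "\<And>j. j \<le> Suc n \<Longrightarrow> 0 < f j"
    and f_0: "f 0 = p 0 * f 1"
    and f_rec: "\<And>j. 1 \<le> j \<Longrightarrow> j \<le> n \<Longrightarrow> f j = p j * f (Suc j) + q j * f (j - 1)"
    and L: "\<And>j. 1 \<le> j \<Longrightarrow> j \<le> n \<Longrightarrow> L j = p (j - 1) * q j"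
    and "j \<le> n"
  shows "(\<Prod>i\<le>j. p i) * f (Suc j) = continuant L j * f 0" and "0 < continuant L j"
proof -
  define u where "u i = (\<Prod>j<i. p j) * f i" for i
  have step: "u (Suc i) = u i - L i * u (i - 1)" if "1 \<le> i" "i \<le> n" for i
  proof -
    obtain l where l: "i = Suc l" using \<open>1 \<le> i\<close> by (cases i) auto
    show ?thesis
      using f_rec[of i] L[of i] that by (simp add: u_def l algebra_simps)
  qed
  have "u 0 = f 0" "u 1 = f 0" by (simp_all add: u_def f_0)
  from continuant_unique[OF this step \<open>j \<le> n\<close>]
  have *: "u (Suc j) = continuant L j * f 0" by simp
  then show "(\<Prod>i\<le>j. p i) * f (Suc j) = continuant L j * f 0"
    by (simp add: u_def lessThan_Suc_atMost)
  have "0 < u (Suc j)"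
    unfolding u_def using p f_pos[of "Suc j"] \<open>j \<le> n\<close> by (intro mult_pos_pos prod_pos) auto
  then show "0 < continuant L j"
    using f_pos[of 0] by (simp add: * zero_less_mult_iff)
qed

subsection \<open>Laws of finite paths\<close>

context site_walk
begin

declare measurable_S [measurable] measurable_D [measurable]

lemma space_K: "space (K j) = UNIV"
  using sets_eq_imp_space_eq[OF sets_K[of j]] by (simp add: space_pair_measure)

lemma measurable_K_iff: "measurable (K j) N = measurable (count_space UNIV \<Otimes>\<^sub>M borel) N"
  by (rule measurable_cong_sets[OF sets_K refl])

lemma emeasure_path:
  assumes B: "\<And>i. i < k \<Longrightarrow> B i \<in> sets borel"
  shows "emeasure (P m) {w \<in> space (P m). (\<forall>i\<le>k. S i w = x i) \<and> (\<forall>i<k. D i w \<in> B i)} =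
    of_bool (x 0 = m) * (\<Prod>i<k. emeasure (K (x i)) ({x (Suc i)} \<times> B i))"
proof -
  interpret P: prob_space "P m" by (rule prob_space_P)
  have eq: "{w \<in> space (P m). (\<forall>i\<le>k. S i w = x i) \<and> (\<forall>i<k. D i w \<in> B i)} =
      {w \<in> space (P m). S k w = x k \<and> (\<forall>i<k. S i w = x i \<and> D i w \<in> B i)}"
    by (auto simp: le_less)
  have K: "ennreal (measure (K j) C) = emeasure (K j) C" for j C
    using prob_space_K[of j] by (simp add: prob_space_def finite_measure.emeasure_eq_measure)
  show ?thesis
    unfolding eq P.emeasure_eq_measure
    by (subst independent_pieces[OF B]) (simp_all add: ennreal_mult' prod_nonneg prod_ennreal[symmetric] K)
qed

lemma AE_start: "AE w in P m. S 0 w = m"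
proof -
  interpret P: prob_space "P m" by (rule prob_space_P)
  have "P.prob {w \<in> space (P m). S 0 w = m} = 1"
    using independent_pieces[of 0 "\<lambda>_. UNIV" m "\<lambda>_. m"] by simp
  then show ?thesis
    by (subst (asm) P.prob_Collect_eq_1) auto
qed

text \<open>Site prefixes of a given length are countably many, and a prefix whose last move
  violates \<open>Q\<close> has probability 0, since the corresponding factor from \<open>K\<close>
  vanishes.\<close>

lemma AE_moves:
  assumes Q: "\<And>i j. {t. \<not> Q i j t} \<in> sets borel"
    and AE_Q: "\<And>i. AE y in K i. Q i (fst y) (snd y)"
  shows "AE w in P m. \<forall>k. Q (S k w) (S (Suc k) w) (D k w)"
  unfolding AE_all_countable
proof
  fix k
  interpret P: prob_space "P m" by (rule prob_space_P)
  \<comment> \<open>Prefixes are encoded as lists, which form a countable type, unlike functions on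
    the naturals.\<close>
  have "AE w in P m. \<not> ((\<forall>i\<le>Suc k. S i w = xs ! i) \<and> \<not> Q (xs ! k) (xs ! Suc k) (D k w))" for xs
  proof -
    define B where "B i = (if i = k then {t. \<not> Q (xs ! k) (xs ! Suc k) t} else UNIV)" for i
    have B: "B i \<in> sets borel" for i by (auto simp: B_def Q)
    have "AE y in K (xs ! k). y \<notin> {xs ! Suc k} \<times> B k"
      using AE_Q[of "xs ! k"] by eventually_elim (auto simp: B_def)
    moreover have "{xs ! Suc k} \<times> B k \<in> sets (K (xs ! k))"
      unfolding sets_K by (intro pair_measureI B) auto
    ultimately have "emeasure (K (xs ! k)) ({xs ! Suc k} \<times> B k) = 0"
      by (subst (asm) AE_iff_measurable[OF _ refl]) (auto simp: space_K)
    then have "(\<Prod>i<Suc k. emeasure (K (xs ! i)) ({xs ! Suc i} \<times> B i)) = 0" by simp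
    then have "emeasure (P m) {w \<in> space (P m). (\<forall>i\<le>Suc k. S i w = xs ! i) \<and> (\<forall>i<Suc k. D i w \<in> B i)} = 0"
      by (subst emeasure_path[OF B]) simp
    moreover have "{w \<in> space (P m). (\<forall>i\<le>Suc k. S i w = xs ! i) \<and> (\<forall>i<Suc k. D i w \<in> B i)} \<in> sets (P m)"
      using B by measurable
    ultimately have null: "{w \<in> space (P m). (\<forall>i\<le>Suc k. S i w = xs ! i) \<and> (\<forall>i<Suc k. D i w \<in> B i)}
        \<in> null_sets (P m)"
      by (rule null_setsI)
    have D_B: "D i w \<in> B i \<longleftrightarrow> (i = k \<longrightarrow> \<not> Q (xs ! k) (xs ! Suc k) (D k w))" for i w
      by (simp add: B_def)
    show ?thesis
      by (rule AE_I'[OF null]) (simp add: D_B Collect_mono_iff del: all_simps)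
  qed
  then have "AE w in P m. \<forall>xs. \<not> ((\<forall>i\<le>Suc k. S i w = xs ! i) \<and> \<not> Q (xs ! k) (xs ! Suc k) (D k w))"
    unfolding AE_all_countable by blast
  then show "AE w in P m. Q (S k w) (S (Suc k) w) (D k w)"
  proof eventually_elim
    case (elim w)
    define xs where "xs = map (\<lambda>i. S i w) [0..<Suc (Suc k)]"
    have xs: "xs ! i = S i w" if "i \<le> Suc k" for i
      using that by (simp add: xs_def del: upt_Suc)
    show ?case using elim[rule_format, of xs] xs by auto
  qed
qed

lemma AE_regular:
  "AE w in P m. S 0 w = m \<and> (\<forall>k. 0 < D k w) \<and>
     (\<forall>k. S k w \<le> n \<longrightarrow> S (Suc k) w = Suc (S k w) \<or> Suc (S (Suc k) w) = S k w)"
proof -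
  have "AE w in P m. \<forall>k. 0 < D k w"
    by (rule AE_moves) (auto simp: duration_pos not_less)
  moreover have "AE w in P m. \<forall>k. S k w \<le> n \<longrightarrow> S (Suc k) w = Suc (S k w) \<or> Suc (S (Suc k) w) = S k w"
  proof (rule AE_moves)
    show "AE y in K i. i \<le> n \<longrightarrow> fst y = Suc i \<or> Suc (fst y) = i" for i
      using nearest_neighbour[of i] by (cases "i \<le> n") auto
  qed simp
  ultimately show ?thesis using AE_start[of m] by eventually_elim auto
qed

text \<open>On the event that the path follows \<open>x\<close>, the durations are distributed
  according to a product measure, so the integral of a product of functions of single durations
  factorises.\<close>

lemma path_nn_integral:
  fixes g :: "nat \<Rightarrow> real \<Rightarrow> ennreal"
  assumes g [measurable]: "\<And>i. g i \<in> borel_measurable borel"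
  shows "(\<integral>\<^sup>+w. (if \<forall>i\<le>k. S i w = x i then \<Prod>i<k. g i (D i w) else 0) \<partial>P m) =
    of_bool (x 0 = m) * (\<Prod>i<k. \<integral>\<^sup>+y. indicator {x (Suc i)} (fst y) * g i (snd y) \<partial>K (x i))"
proof -
  define E where "E = {w \<in> space (P m). \<forall>i\<le>k. S i w = x i}"
  have E [measurable]: "E \<in> sets (P m)" unfolding E_def by measurable
  have fst_K [measurable]: "fst \<in> measurable (K j) (count_space UNIV)" for j
    unfolding measurable_K_iff by measurable
  have snd_K [measurable]: "snd \<in> measurable (K j) borel" for j
    unfolding measurable_K_iff by measurable
  \<comment> \<open>Unnormalised law of the duration of a move from \<open>x i\<close> to
    \<open>x (i + 1)\<close>; its total mass is the probability of that move.\<close>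
  define \<nu> where "\<nu> i = distr (density (K (x i)) (\<lambda>y. indicator {x (Suc i)} (fst y))) borel snd" for i
  have ind: "(\<lambda>y. indicator {c} (fst y) :: ennreal) \<in> borel_measurable (K j)" for c j
    by (rule measurable_compose[OF fst_K]) simp
  have sets_\<nu>: "sets (\<nu> i) = sets borel" for i by (simp add: \<nu>_def)
  have nn_\<nu>: "(\<integral>\<^sup>+t. h t \<partial>\<nu> i) = (\<integral>\<^sup>+y. indicator {x (Suc i)} (fst y) * h (snd y) \<partial>K (x i))"
    if [measurable]: "h \<in> borel_measurable borel" for h i
    unfolding \<nu>_def using ind by (subst nn_integral_distr) (auto simp: nn_integral_density)
  have em_\<nu>: "emeasure (\<nu> i) B = emeasure (K (x i)) ({x (Suc i)} \<times> B)" if "B \<in> sets borel" for i B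
  proof -
    have "emeasure (\<nu> i) B = (\<integral>\<^sup>+y. indicator {x (Suc i)} (fst y) * indicator B (snd y) \<partial>K (x i))"
      using that nn_\<nu>[of "indicator B" i] by (simp add: sets_\<nu>)
    also have "\<dots> = (\<integral>\<^sup>+y. indicator ({x (Suc i)} \<times> B) y \<partial>K (x i))"
      by (intro nn_integral_cong) (auto simp: indicator_def)
    also have "\<dots> = emeasure (K (x i)) ({x (Suc i)} \<times> B)"
      by (rule nn_integral_indicator) (auto simp: sets_K intro!: pair_measureI that)
    finally show ?thesis .
  qed
  have fin: "finite_measure (\<nu> i)" for i
  proof (rule finite_measureI)
    interpret K: prob_space "K (x i)" by (rule prob_space_K)
    show "emeasure (\<nu> i) (space (\<nu> i)) \<noteq> \<infinity>"
      using em_\<nu>[of UNIV i] sets_eq_imp_space_eq[OF sets_\<nu>[of i]] K.emeasure_finite by simp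
  qed
  interpret \<nu>: product_sigma_finite \<nu>
    using fin by (simp add: product_sigma_finite_def finite_measure_def)
  define J where "J w = (\<lambda>i\<in>{..<k}. D i w)" for w
  have J [measurable]: "J \<in> measurable (P m) (PiM {..<k} (\<lambda>_. borel))"
    unfolding J_def by measurable
  define N where "N = distr (density (P m) (indicator E)) (PiM {..<k} (\<lambda>_. borel)) J"
  show ?thesis
  proof (cases "x 0 = m")
    case False
    have "(\<integral>\<^sup>+w. (if \<forall>i\<le>k. S i w = x i then \<Prod>i<k. g i (D i w) else 0) \<partial>P m) = (\<integral>\<^sup>+w. 0 \<partial>P m)"
      using AE_start[of m] False by (intro nn_integral_cong_AE) auto
    then show ?thesis using False by simp
  next
    case True
    \<comment> \<open>Boxes determine a product of finite measures, and on boxes the law is given by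
      \<open>emeasure_path\<close>.\<close>
    have N_eq: "N = PiM {..<k} \<nu>"
    proof (rule \<nu>.PiM_eqI)
      show "sets N = sets (PiM {..<k} \<nu>)"
        unfolding N_def by (simp add: sets_\<nu> cong: sets_PiM_cong)
    next
      fix A assume A: "\<And>i. i \<in> {..<k} \<Longrightarrow> A i \<in> sets (\<nu> i)"
      then have A': "\<And>i. i < k \<Longrightarrow> A i \<in> sets borel" by (simp add: sets_\<nu>)
      then have PA [measurable]: "Pi\<^sub>E {..<k} A \<in> sets (PiM {..<k} (\<lambda>_. borel))"
        by (intro sets_PiM_I_finite) auto
      have "emeasure N (Pi\<^sub>E {..<k} A) = emeasure (density (P m) (indicator E)) (J -` Pi\<^sub>E {..<k} A \<inter> space (P m))"
        unfolding N_def by (subst emeasure_distr) auto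
      also have "\<dots> = emeasure (P m) (E \<inter> (J -` Pi\<^sub>E {..<k} A \<inter> space (P m)))"
        by (subst emeasure_density) (auto simp: nn_integral_indicator[symmetric] indicator_inter_arith)
      also have "E \<inter> (J -` Pi\<^sub>E {..<k} A \<inter> space (P m)) =
          {w \<in> space (P m). (\<forall>i\<le>k. S i w = x i) \<and> (\<forall>i<k. D i w \<in> A i)}"
        by (auto simp: E_def J_def PiE_iff)
      also have "emeasure (P m) \<dots> = (\<Prod>i<k. emeasure (\<nu> i) (A i))"
        using A' True by (subst emeasure_path) (auto simp: em_\<nu>)
      finally show "emeasure N (Pi\<^sub>E {..<k} A) = (\<Prod>i\<in>{..<k}. emeasure (\<nu> i) (A i))" .
    qed simp
    have "(\<integral>\<^sup>+w. (if \<forall>i\<le>k. S i w = x i then \<Prod>i<k. g i (D i w) else 0) \<partial>P m)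
        = (\<integral>\<^sup>+w. indicator E w * (\<Prod>i<k. g i (J w i)) \<partial>P m)"
      by (intro nn_integral_cong) (auto simp: E_def J_def)
    also have "\<dots> = (\<integral>\<^sup>+w. (\<Prod>i<k. g i (J w i)) \<partial>density (P m) (indicator E))"
      by (subst nn_integral_density) auto
    also have "\<dots> = (\<integral>\<^sup>+v. (\<Prod>i<k. g i (v i)) \<partial>N)"
      unfolding N_def by (subst nn_integral_distr) auto
    also have "\<dots> = (\<Prod>i<k. \<integral>\<^sup>+t. g i t \<partial>\<nu> i)"
      unfolding N_eq by (rule \<nu>.product_nn_integral_prod) (auto simp: measurable_cong_sets[OF sets_\<nu> refl])
    finally show ?thesis using True by (simp add: nn_\<nu>)
  qed
qed

section \<open>Hitting times along a path with positive durations\<close>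

lemma hit_time_INF:
  "hit_time S D a w = (INF k. if S k w = a then ereal (\<Sum>i<k. D i w) else \<infinity>)"
proof (rule antisym)
  show "hit_time S D a w \<le> (INF k. if S k w = a then ereal (\<Sum>i<k. D i w) else \<infinity>)"
    unfolding hit_time_def by (intro INF_greatest) (auto intro: Inf_lower)
  show "(INF k. if S k w = a then ereal (\<Sum>i<k. D i w) else \<infinity>) \<le> hit_time S D a w"
    unfolding hit_time_def
  proof (rule Inf_greatest, clarify)
    fix l assume "a = S l w"
    then show "(INF k. if S k w = S l w then ereal (\<Sum>i<k. D i w) else \<infinity>) \<le> ereal (\<Sum>i<l. D i w)"
      by (intro INF_lower2[of l]) auto
  qed
qed

lemma measurable_hit_time [measurable]: "hit_time S D a \<in> borel_measurable (P m)"
  unfolding hit_time_INF[abs_def] by measurable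

lemma measurable_hit_exp [measurable]: "hit_exp S D s a \<in> borel_measurable (P m)"
  unfolding hit_exp_def[abs_def] by measurable

text \<open>Durations are positive, so elapsed time increases with the number of moves, and a site
  avoided up to index k needs at least k + 1 moves.\<close>

lemma hit_time_ge:
  assumes D: "\<And>i. 0 < D i w" and "\<And>i. i \<le> k \<Longrightarrow> S i w \<noteq> a"
  shows "ereal (\<Sum>i<Suc k. D i w) \<le> hit_time S D a w"
  unfolding hit_time_def
proof (rule Inf_greatest, clarify)
  fix l assume "a = S l w"
  then have "Suc k \<le> l" using assms(2)[of l] by force
  then show "ereal (\<Sum>i<Suc k. D i w) \<le> ereal (\<Sum>i<l. D i w)"
    unfolding ereal_less_eq using D by (intro sum_mono2) (auto intro: less_imp_le)
qed

lemma hit_time_first: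
  assumes D: "\<And>i. 0 < D i w" and "S k w = a" "\<And>i. i < k \<Longrightarrow> S i w \<noteq> a"
  shows "hit_time S D a w = ereal (\<Sum>i<k. D i w)"
proof (rule antisym)
  show "hit_time S D a w \<le> ereal (\<Sum>i<k. D i w)"
    unfolding hit_time_def using assms(2) by (intro Inf_lower) auto
  show "ereal (\<Sum>i<k. D i w) \<le> hit_time S D a w"
    unfolding hit_time_def
  proof (rule Inf_greatest, clarify)
    fix l assume "a = S l w"
    then have "k \<le> l" using assms(3)[of l] by force
    then show "ereal (\<Sum>i<k. D i w) \<le> ereal (\<Sum>i<l. D i w)"
      unfolding ereal_less_eq using D by (intro sum_mono2) (auto intro: less_imp_le)
  qed
qed

section \<open>Generating functions of a single move\<close>

definition step_mgf :: "real \<Rightarrow> nat \<Rightarrow> nat \<Rightarrow> ennreal" where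
  "step_mgf s i j = (\<integral>\<^sup>+y. indicator {j} (fst y) * ennreal (exp (s * snd y)) \<partial>K i)"

lemma path_mgf:
  "(\<integral>\<^sup>+w. (if \<forall>i\<le>k. S i w = x i then \<Prod>i<k. ennreal (exp (s * D i w)) else 0) \<partial>P m) =
    of_bool (x 0 = m) * (\<Prod>i<k. step_mgf s (x i) (x (Suc i)))"
  unfolding step_mgf_def by (rule path_nn_integral) measurable

lemma first_step_mgf:
  "(\<integral>\<^sup>+w. (if S 1 w = j then ennreal (exp (s * D 0 w)) else 0) \<partial>P m) = step_mgf s m j"
proof -
  have "(\<integral>\<^sup>+w. (if S 1 w = j then ennreal (exp (s * D 0 w)) else 0) \<partial>P m) =
    (\<integral>\<^sup>+w. (if \<forall>i\<le>1. S i w = (if i = 0 then m else j) then \<Prod>i<1. ennreal (exp (s * D i w)) else 0) \<partial>P m)"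
    using AE_start[of m] by (intro nn_integral_cong_AE, eventually_elim) (auto simp: le_Suc_eq)
  then show ?thesis by (subst (asm) path_mgf) simp
qed

text \<open>No integrability is assumed: if the expectation is infinite, both sides are 0, the left
  one as the integral of a nonintegrable function and the right one as \<open>enn2real\<close> of
  infinity.\<close>

lemma first_step_integral:
  assumes [measurable]: "h \<in> borel_measurable (P m)"
    and h: "AE w in P m. h w = (if S 1 w = j then exp (s * D 0 w) else 0)"
  shows "(\<integral>w. h w \<partial>P m) = enn2real (step_mgf s m j)"
proof -
  have "(\<integral>w. h w \<partial>P m) = (\<integral>w. (if S 1 w = j then exp (s * D 0 w) else 0) \<partial>P m)"
    using h by (intro integral_cong_AE) auto
  also have "\<dots> = enn2real (\<integral>\<^sup>+w. ennreal (if S 1 w = j then exp (s * D 0 w) else 0) \<partial>P m)"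
    by (intro integral_eq_nn_integral) auto
  also have "(\<integral>\<^sup>+w. ennreal (if S 1 w = j then exp (s * D 0 w) else 0) \<partial>P m) = step_mgf s m j"
    unfolding first_step_mgf[symmetric] by (intro nn_integral_cong) auto
  finally show ?thesis .
qed

lemma hit_mgf_0_1: "hit_mgf P S D s 0 1 = enn2real (step_mgf s 0 1)"
  unfolding hit_mgf_def
proof (rule first_step_integral)
  show "AE w in P 0. hit_exp S D s 1 w = (if S 1 w = 1 then exp (s * D 0 w) else 0)"
    using AE_regular[of 0]
  proof eventually_elim
    case (elim w)
    then have "S 1 w = 1" using elim[THEN conjunct2, THEN conjunct2, rule_format, of 0] by simp
    then show ?case
      using elim hit_time_first[of w 1 1] by (simp add: hit_exp_def)
  qed
qed measurable

text \<open>The first move leads to one of the two neighbours and thereby decides which is hit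
  first.\<close>

lemma hit_mgf_before_neighbour:
  assumes "j \<le> n" and ab: "a = Suc j \<and> Suc b = j \<or> Suc a = j \<and> b = Suc j"
  shows "hit_mgf_before P S D s j a b = enn2real (step_mgf s j a)"
  unfolding hit_mgf_before_def
proof (rule first_step_integral)
  show "AE w in P j. (if hit_time S D a w < hit_time S D b w then hit_exp S D s a w else 0) =
      (if S 1 w = a then exp (s * D 0 w) else 0)"
    using AE_regular[of j]
  proof eventually_elim
    case (elim w)
    then have D: "\<And>i. 0 < D i w" and S0: "S 0 w = j" by auto
    have "S 1 w = Suc j \<or> Suc (S 1 w) = j"
      using elim[THEN conjunct2, THEN conjunct2, rule_format, of 0] \<open>j \<le> n\<close> S0 by simp
    then consider "S 1 w = a" | "S 1 w = b" using ab by auto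
    then show ?case
    proof cases
      case 1
      \<comment> \<open>Reaching \<open>b\<close> now takes at least two moves, and the positive
        second duration makes the comparison of hitting times strict.\<close>
      have "i \<le> 1 \<Longrightarrow> S i w \<noteq> b" for i using 1 S0 ab by (cases i) auto
      from hit_time_ge[of w 1, OF D this] have "ereal (D 0 w + D 1 w) \<le> hit_time S D b w" by simp
      moreover have a: "hit_time S D a w = ereal (D 0 w)"
        using hit_time_first[of w 1 a] D S0 1 ab by auto
      moreover have "ereal (D 0 w) < ereal (D 0 w + D 1 w)" using D[of 1] by simp
      ultimately have "hit_time S D a w < hit_time S D b w" by (metis order_less_le_trans)
      then show ?thesis using 1 a by (simp add: hit_exp_def)
    next
      case 2
      have "i \<le> 0 \<Longrightarrow> S i w \<noteq> a" for i using S0 ab by auto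
      from hit_time_ge[of w 0, OF D this] have "ereal (D 0 w) \<le> hit_time S D a w" by simp
      moreover have "hit_time S D b w = ereal (D 0 w)"
        using hit_time_first[of w 1 b] D S0 2 ab by auto
      ultimately show ?thesis using 2 ab by auto
    qed
  qed
qed measurable

end

subsection \<open>First passage\<close>

text \<open>Total weight of the nearest-neighbour paths from m that reach n + 1 for the first time
  after exactly k moves, decomposed by the first move.\<close>

primrec passage_weight :: "nat \<Rightarrow> (nat \<Rightarrow> nat \<Rightarrow> ennreal) \<Rightarrow> nat \<Rightarrow> nat \<Rightarrow> ennreal" where
  "passage_weight n W 0 m = of_bool (m = Suc n)"
| "passage_weight n W (Suc k) m =
     (if m \<le> n then W m (Suc m) * passage_weight n W k (Suc m) +
        (if m = 0 then 0 else W m (m - 1) * passage_weight n W k (m - 1)) else 0)"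

text \<open>Every path from i \<le> j to n + 1 must cross from j to j + 1, where it picks up a zero
  factor.\<close>

lemma passage_weight_eq_0:
  assumes "W j (Suc j) = 0" "i \<le> j" "j \<le> n"
  shows "passage_weight n W k i = 0"
  using assms(2)
proof (induction k arbitrary: i)
  case 0
  then show ?case using assms by simp
next
  case (Suc k)
  then show ?case using assms by (cases "i = j") auto
qed

context site_walk
begin

definition first_hits :: "nat \<Rightarrow> nat \<Rightarrow> 'w \<Rightarrow> bool" where
  "first_hits l k w \<longleftrightarrow> S (l + k) w = Suc n \<and> (\<forall>i. l \<le> i \<and> i < l + k \<longrightarrow> S i w \<le> n)"

lemma measurable_first_hits [measurable]: "Measurable.pred (P m) (first_hits l k)"
  unfolding first_hits_def[abs_def] by measurable

lemma first_hits_Suc: "first_hits l (Suc k) w \<longleftrightarrow> S l w \<le> n \<and> first_hits (Suc l) k w"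
  unfolding first_hits_def by (auto simp: le_eq_less_or_eq[of l] Suc_le_eq)

text \<open>Carrying the prefix \<open>x\<close> along replaces the Markov property in the induction on \<open>k\<close>.\<close>

lemma prefix_passage_mgf:
  "(\<integral>\<^sup>+w. (if (\<forall>i\<le>l. S i w = x i) \<and> first_hits l k w
       then \<Prod>i<l+k. ennreal (exp (s * D i w)) else 0) \<partial>P m) =
    of_bool (x 0 = m) * (\<Prod>i<l. step_mgf s (x i) (x (Suc i))) *
      passage_weight n (step_mgf s) k (x l)"
proof (induction k arbitrary: l x)
  case 0
  have "(\<integral>\<^sup>+w. (if (\<forall>i\<le>l. S i w = x i) \<and> first_hits l 0 w
       then \<Prod>i<l+0. ennreal (exp (s * D i w)) else 0) \<partial>P m) =
     (\<integral>\<^sup>+w. of_bool (x l = Suc n) * (if (\<forall>i\<le>l. S i w = x i)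
       then \<Prod>i<l. ennreal (exp (s * D i w)) else 0) \<partial>P m)"
    by (intro nn_integral_cong) (auto simp: first_hits_def)
  also have "\<dots> = of_bool (x l = Suc n) * (of_bool (x 0 = m) * (\<Prod>i<l. step_mgf s (x i) (x (Suc i))))"
    by (subst nn_integral_cmult) (auto simp: path_mgf)
  finally show ?case by (simp add: mult_ac)
next
  case (Suc k)
  define G where "G y w = (if (\<forall>i\<le>Suc l. S i w = y i) \<and> first_hits (Suc l) k w
       then \<Prod>i<Suc l+k. ennreal (exp (s * D i w)) else 0)" for y w
  have [measurable]: "G y \<in> borel_measurable (P m)" for y
    unfolding G_def[abs_def] by measurable
  \<comment> \<open>\<open>u j\<close> prolongs the prefix by the site j at position l + 1; the
    induction hypothesis holds for every prefix and so applies to it.\<close>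
  define u where "u j = x(Suc l := j)" for j
  have upd: "(\<integral>\<^sup>+w. G (u j) w \<partial>P m) = of_bool (x 0 = m) * (\<Prod>i<l. step_mgf s (x i) (x (Suc i))) *
      (step_mgf s (x l) j * passage_weight n (step_mgf s) k j)" for j
    unfolding G_def Suc.IH by (simp add: u_def mult_ac)
  \<comment> \<open>Almost surely the site after \<open>x l\<close> is one of its neighbours, so the
    integrand splits into at most two terms with longer prefixes.\<close>
  have *: "AE w in P m. (if (\<forall>i\<le>l. S i w = x i) \<and> first_hits l (Suc k) w
       then \<Prod>i<l+Suc k. ennreal (exp (s * D i w)) else 0) =
     (if x l \<le> n then G (u (Suc (x l))) w + (if x l = 0 then 0 else G (u (x l - 1)) w) else 0)"
    using AE_regular[of m]
  proof eventually_elim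
    case (elim w)
    then have "S l w \<le> n \<Longrightarrow> S (Suc l) w = Suc (S l w) \<or> Suc (S (Suc l) w) = S l w" by blast
    then show ?case
      by (auto simp: first_hits_Suc G_def u_def le_Suc_eq)
  qed
  show ?case
  proof (cases "x l \<le> n")
    case True
    then show ?thesis
      by (subst nn_integral_cong_AE[OF *], cases "x l = 0")
        (simp_all add: nn_integral_add upd distrib_left)
  next
    case False
    then show ?thesis by (subst nn_integral_cong_AE[OF *]) simp
  qed
qed

definition passage_mgf :: "real \<Rightarrow> nat \<Rightarrow> ennreal" where
  "passage_mgf s m = (\<Sum>k. passage_weight n (step_mgf s) k m)"

text \<open>At most one summand is nonzero, namely the one for the first visit to n + 1. The walk
  cannot jump over n + 1, hence it stays in 0, ..., n until then.\<close>

lemma hit_exp_eq_suminf: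
  assumes "S 0 w \<le> n" and D: "\<And>i. 0 < D i w"
    and step: "\<And>k. S k w \<le> n \<Longrightarrow> S (Suc k) w \<le> Suc n"
  shows "ennreal (hit_exp S D s (Suc n) w) =
    (\<Sum>k. if first_hits 0 k w then \<Prod>i<k. ennreal (exp (s * D i w)) else 0)"
proof (cases "\<exists>k. S k w = Suc n")
  case False
  then have "hit_time S D (Suc n) w = \<infinity>"
    by (simp add: hit_time_INF)
  moreover have "\<not> first_hits 0 k w" for k using False by (simp add: first_hits_def)
  ultimately show ?thesis by (simp add: hit_exp_def)
next
  case True
  define k where "k = (LEAST k. S k w = Suc n)"
  have k: "S k w = Suc n" using True unfolding k_def by (rule LeastI_ex)
  have before: "i < k \<Longrightarrow> S i w \<noteq> Suc n" for i unfolding k_def by (rule not_less_Least)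
  have le_n: "S i w \<le> n" if "i < k" for i
    using that
  proof (induction i)
    case 0
    then show ?case using assms by simp
  next
    case (Suc i)
    then show ?case using step[of i] before[of "Suc i"] by simp
  qed
  have hits: "first_hits 0 j w \<longleftrightarrow> j = k" for j
  proof
    assume "first_hits 0 j w"
    then have "S j w = Suc n" "\<not> k < j" using k by (auto simp: first_hits_def)
    then show "j = k" using before[of j] by force
  qed (use k le_n in \<open>auto simp: first_hits_def\<close>)
  have "hit_time S D (Suc n) w = ereal (\<Sum>i<k. D i w)"
    using D k before by (rule hit_time_first)
  then have "ennreal (hit_exp S D s (Suc n) w) = (\<Prod>i<k. ennreal (exp (s * D i w)))"
    by (simp add: hit_exp_def sum_distrib_left exp_sum prod_ennreal)
  also have "\<dots> = (\<Sum>j. if first_hits 0 j w then \<Prod>i<j. ennreal (exp (s * D i w)) else 0)"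
    using suminf_finite[of "{k}" "\<lambda>j. if first_hits 0 j w then \<Prod>i<j. ennreal (exp (s * D i w)) else 0"]
    by (simp add: hits)
  finally show ?thesis .
qed

lemma nn_integral_hit_exp:
  assumes "m \<le> n"
  shows "(\<integral>\<^sup>+w. ennreal (hit_exp S D s (Suc n) w) \<partial>P m) = passage_mgf s m"
proof -
  have "AE w in P m. ennreal (hit_exp S D s (Suc n) w) =
      (\<Sum>k. if first_hits 0 k w then \<Prod>i<k. ennreal (exp (s * D i w)) else 0)"
    using AE_regular[of m]
  proof eventually_elim
    case (elim w)
    have "S (Suc k) w \<le> Suc n" if "S k w \<le> n" for k
      using elim[THEN conjunct2, THEN conjunct2, rule_format, of k] that by auto
    then show ?case using elim assms by (intro hit_exp_eq_suminf) simp_all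
  qed
  then have "(\<integral>\<^sup>+w. ennreal (hit_exp S D s (Suc n) w) \<partial>P m) =
      (\<integral>\<^sup>+w. (\<Sum>k. if first_hits 0 k w then \<Prod>i<k. ennreal (exp (s * D i w)) else 0) \<partial>P m)"
    by (rule nn_integral_cong_AE)
  also have "\<dots> = (\<Sum>k. \<integral>\<^sup>+w. (if first_hits 0 k w then \<Prod>i<k. ennreal (exp (s * D i w)) else 0) \<partial>P m)"
    by (rule nn_integral_suminf) measurable
  also have "\<dots> = passage_mgf s m"
    unfolding passage_mgf_def
  proof (rule suminf_cong)
    fix k
    have "(\<integral>\<^sup>+w. (if first_hits 0 k w then \<Prod>i<k. ennreal (exp (s * D i w)) else 0) \<partial>P m) =
      (\<integral>\<^sup>+w. (if (\<forall>i\<le>0. S i w = m) \<and> first_hits 0 k w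
         then \<Prod>i<0+k. ennreal (exp (s * D i w)) else 0) \<partial>P m)"
      using AE_start[of m] by (intro nn_integral_cong_AE, eventually_elim) simp
    then show "(\<integral>\<^sup>+w. (if first_hits 0 k w then \<Prod>i<k. ennreal (exp (s * D i w)) else 0) \<partial>P m) =
        passage_weight n (step_mgf s) k m"
      using prefix_passage_mgf[where l=0 and x="\<lambda>_. m" and k=k and s=s and m=m] by simp
  qed
  finally show ?thesis .
qed

lemma passage_mgf_split:
  "passage_mgf s m = of_bool (m = Suc n) + (\<Sum>k. passage_weight n (step_mgf s) (Suc k) m)"
  unfolding passage_mgf_def by (subst suminf_offset[where i=1]) (simp_all add: add.commute)

lemma passage_mgf_target: "passage_mgf s (Suc n) = 1"
  by (simp add: passage_mgf_split)

text \<open>From m \<le> n the term for zero moves vanishes, and the first move is split off in all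
  others. In \<open>ennreal\<close> this needs no convergence.\<close>

lemma passage_mgf_rec:
  assumes "m \<le> n"
  shows "passage_mgf s m = step_mgf s m (Suc m) * passage_mgf s (Suc m) +
    (if m = 0 then 0 else step_mgf s m (m - 1) * passage_mgf s (m - 1))"
  using assms unfolding passage_mgf_split[of s m]
  by (simp add: passage_mgf_def suminf_add[symmetric] ennreal_suminf_cmult)

lemma loop_mgf_eq:
  assumes "1 \<le> j" "j \<le> n"
  shows "loop_mgf P S D s j = enn2real (step_mgf s (j - 1) j) * enn2real (step_mgf s j (j - 1))"
proof -
  have "hit_mgf_before P S D s j (j - 1) (j + 1) = enn2real (step_mgf s j (j - 1))"
    using assms by (intro hit_mgf_before_neighbour) auto
  moreover have "hit_mgf_before P S D s (j - 1) j (j - 2) = enn2real (step_mgf s (j - 1) j)" if "j \<noteq> 1"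
    using assms that by (intro hit_mgf_before_neighbour) auto
  ultimately show ?thesis using hit_mgf_0_1[of s] by (auto simp: loop_mgf_def)
qed

lemma prod_step_mgf:
  "hit_mgf P S D s 0 1 * (\<Prod>j=1..n. hit_mgf_before P S D s j (j + 1) (j - 1)) =
    (\<Prod>j\<le>n. enn2real (step_mgf s j (Suc j)))"
proof -
  have "(\<Prod>j=1..n. hit_mgf_before P S D s j (j + 1) (j - 1)) =
      (\<Prod>j=1..n. enn2real (step_mgf s j (Suc j)))"
    by (intro prod.cong refl) (simp add: hit_mgf_before_neighbour)
  then show ?thesis
    using hit_mgf_0_1[of s] by (simp add: atMost_atLeast0 prod.atLeast_Suc_atMost)
qed

end

section \<open>The three expressions for the passage from 0 to n + 1\<close>

theorem theorem3p1:
  fixes n :: nat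
    and P :: "nat \<Rightarrow> 'w measure"
    and S :: "nat \<Rightarrow> 'w \<Rightarrow> nat"
    and D :: "nat \<Rightarrow> 'w \<Rightarrow> real"
    and K :: "nat \<Rightarrow> (nat \<times> real) measure"
    and s :: real
    and A :: real
    and L :: "nat \<Rightarrow> real"
  assumes walk: "site_walk n P S D K"
    and n: "n \<ge> 1"
    and mgf_finite: "integrable (P 0) (hit_exp S D s (n + 1))"
  defines "A \<equiv> hit_mgf P S D s 0 1 * (\<Prod>j=1..n. hit_mgf_before P S D s j (j + 1) (j - 1))"
    and "L \<equiv> loop_mgf P S D s"
  shows "(hit_mgf P S D s 0 (n + 1) = A * (\<Sum>k. \<Sum>is\<in>loop_seqs n k. \<Prod>t<k. L (is ! t))) \<and>
    (A * (\<Sum>k. \<Sum>is\<in>loop_seqs n k. \<Prod>t<k. L (is ! t)) =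
         A * (\<Sum>k. ((\<Sum>j=1..n. L j) +
           (\<Sum>js\<in>separated_seqs n. (- 1) ^ (length js + 1) * (\<Prod>m<length js. L (js ! m)))) ^ k)) \<and>
    (A * (\<Sum>k. ((\<Sum>j=1..n. L j) +
           (\<Sum>js\<in>separated_seqs n. (- 1) ^ (length js + 1) * (\<Prod>m<length js. L (js ! m)))) ^ k) =
         A * (1 / (1 - (\<Sum>j=1..n. L j) +
           (\<Sum>js\<in>separated_seqs n. (- 1) ^ length js * (\<Prod>m<length js. L (js ! m)))))) \<and>
    (A \<noteq> 0 \<longrightarrow>
       summable (\<lambda>k. \<Sum>is\<in>loop_seqs n k. \<Prod>t<k. L (is ! t)) \<and>
       summable (\<lambda>k. ((\<Sum>j=1..n. L j) +
           (\<Sum>js\<in>separated_seqs n. (- 1) ^ (length js + 1) * (\<Prod>m<length js. L (js ! m)))) ^ k) \<and>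
       1 - (\<Sum>j=1..n. L j) +
           (\<Sum>js\<in>separated_seqs n. (- 1) ^ length js * (\<Prod>m<length js. L (js ! m))) \<noteq> 0)"
proof -
  interpret site_walk n P S D K by (rule walk)
  let ?W = "step_mgf s" and ?f = "passage_mgf s"
  have A: "A = (\<Prod>j\<le>n. enn2real (?W j (Suc j)))"
    unfolding A_def by (rule prod_step_mgf)
  have nonneg: "0 \<le> hit_exp S D s (n + 1) w" for w
    by (simp add: hit_exp_def)
  have nn: "(\<integral>\<^sup>+w. ennreal (hit_exp S D s (n + 1) w) \<partial>P 0) = ?f 0"
    using nn_integral_hit_exp[of 0 s] by simp
  have mgf: "hit_mgf P S D s 0 (n + 1) = enn2real (?f 0)"
    unfolding hit_mgf_def nn[symmetric] by (rule integral_eq_nn_integral) (use nonneg in auto)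
  \<comment> \<open>This is where integrability enters; finiteness of all other generating functions
    is derived from it.\<close>
  have f_0: "?f 0 < \<infinity>"
    using mgf_finite nonneg unfolding integrable_iff_bounded nn[symmetric] by simp
  show ?thesis
  proof (cases "\<exists>j\<le>n. ?W j (Suc j) = 0")
    \<comment> \<open>Site n + 1 is almost surely not reached and \<open>A\<close> is 0, so the
      identities read 0 = 0 whatever the values of the series, and the last clause is
      vacuous.\<close>
    case True
    then obtain j where j: "j \<le> n" "?W j (Suc j) = 0" by blast
    then have "A = 0" unfolding A by (intro prod_zero bexI[of _ j]) auto
    moreover have "?f 0 = 0"
      using passage_weight_eq_0[of ?W j 0 n] j by (simp add: passage_mgf_def)
    ultimately show ?thesis using mgf by simp
  next
    case False
    then have W_nz: "?W j (Suc j) \<noteq> 0" if "j \<le> n" for j using that by blast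
    \<comment> \<open>Descending from the value 1 at n + 1: the up-move term of the first-step
      equation is already nonzero.\<close>
    have f_nz: "?f j \<noteq> 0" if "j \<le> Suc n" for j
      using that
    proof (induction j rule: inc_induct)
      case base
      then show ?case by (simp add: passage_mgf_target)
    next
      case (step j)
      then show ?case using passage_mgf_rec[of j s] W_nz[of j] by auto
    qed
    \<comment> \<open>Ascending from 0: a finite value at j bounds the up-move term, whose
      coefficient is nonzero, and so forces finiteness at j + 1.\<close>
    have f_fin: "?f j < \<top>" if "j \<le> Suc n" for j
      using that
    proof (induction j)
      case 0
      then show ?case using f_0 by simp
    next
      case (Suc j)
      then show ?case using passage_mgf_rec[of j s] W_nz[of j]
        by (auto simp: ennreal_mult_less_top)
    qed
    have W_fin: "?W j (Suc j) < \<top>" if "j \<le> n" for j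
      using passage_mgf_rec[of j s] f_fin[of j] f_nz[of "Suc j"] that
      by (auto simp: ennreal_mult_less_top)
    have V_fin: "?W j (j - 1) < \<top>" if "1 \<le> j" "j \<le> n" for j
      using passage_mgf_rec[of j s] f_fin[of j] f_nz[of "j - 1"] that
      by (auto simp: ennreal_mult_less_top)
    define p q f where "p j = enn2real (?W j (Suc j))" and "q j = enn2real (?W j (j - 1))"
      and "f j = enn2real (?f j)" for j
    have p: "0 < p j" if "j \<le> n" for j
      using W_nz[OF that] W_fin[OF that] by (simp add: p_def enn2real_positive_iff zero_less_iff_neq_zero)
    have f_pos: "0 < f j" if "j \<le> Suc n" for j
      using f_nz[OF that] f_fin[OF that] by (simp add: f_def enn2real_positive_iff zero_less_iff_neq_zero)
    have f0: "f 0 = p 0 * f 1"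
      using passage_mgf_rec[of 0 s] by (simp add: f_def p_def enn2real_mult)
    \<comment> \<open>\<open>enn2real\<close> is additive on finite values only, hence the
      finiteness facts for both moves and both neighbouring sites.\<close>
    have f_rec: "f j = p j * f (Suc j) + q j * f (j - 1)" if "1 \<le> j" "j \<le> n" for j
      using passage_mgf_rec[of j s] that W_fin[of j] V_fin[of j] f_fin[of "Suc j"] f_fin[of "j - 1"]
      by (simp add: f_def p_def q_def enn2real_mult enn2real_plus ennreal_mult_less_top)
    have L: "L j = p (j - 1) * q j" if "1 \<le> j" "j \<le> n" for j
      using that by (simp add: L_def loop_mgf_eq p_def q_def)
    have L_nonneg: "0 \<le> L j" if "1 \<le> j" "j \<le> n" for j
      using L[OF that] by (simp add: p_def q_def)
    note cont = continuant_first_passage[where n=n and p=p and q=q and f=f and L=L, OF p f_pos f0 f_rec L]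
    let ?D = "continuant L n"
    have D_pos: "0 < continuant L j" if "j \<le> n" for j
      using cont(2) that by blast
    have "f (Suc n) = 1" by (simp add: f_def passage_mgf_target)
    then have A_eq: "A = ?D * f 0" using cont(1)[of n] by (simp add: A p_def)
    have hit: "hit_mgf P S D s 0 (n + 1) = A * (1 / ?D)"
      using D_pos[of n] mgf by (simp add: A_eq f_def)
    have loops: "(\<lambda>k. \<Sum>is\<in>loop_seqs n k. \<Prod>t<k. L (is ! t)) sums (1 / ?D)"
      using L_nonneg D_pos by (rule loop_seqs_sums)
    have den: "1 - (\<Sum>j=1..n. L j) +
        (\<Sum>js\<in>separated_seqs n. (- 1) ^ length js * (\<Prod>m<length js. L (js ! m))) = ?D"
      by (rule sum_separated_seqs)
    \<comment> \<open>All terms are nonnegative, and the empty word alone contributes 1.\<close>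
    have "1 \<le> 1 / ?D"
    proof -
      have "(\<Sum>k\<in>{0}. \<Sum>is\<in>loop_seqs n k. \<Prod>t<k. L (is ! t)) \<le> (\<Sum>k. \<Sum>is\<in>loop_seqs n k. \<Prod>t<k. L (is ! t))"
        using loop_weight_nonneg[of n L _ 0] L_nonneg sums_summable[OF loops]
        by (intro sum_le_suminf) (auto simp: loop_weight_def loop_seqs_from_1)
      then show ?thesis
        using sums_unique[OF loops] loop_weight_0[of L n 0] by (simp add: loop_weight_def loop_seqs_from_1)
    qed
    then have "?D \<le> 1" using D_pos[of n] by simp
    let ?c = "(\<Sum>j=1..n. L j) +
        (\<Sum>js\<in>separated_seqs n. (- 1) ^ (length js + 1) * (\<Prod>m<length js. L (js ! m)))"
    have c: "?c = 1 - ?D"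
      unfolding den[symmetric] by (simp add: sum_negf)
    \<comment> \<open>The ratio 1 - D_n lies in [0, 1) because 0 < D_n \<le> 1.\<close>
    have geo: "(\<lambda>k. ?c ^ k) sums (1 / ?D)"
      unfolding c using geometric_sums[of "1 - ?D"] D_pos[of n] \<open>?D \<le> 1\<close> by simp
    show ?thesis
      unfolding den sums_unique[OF loops, symmetric] sums_unique[OF geo, symmetric] hit
      using sums_summable[OF loops] sums_summable[OF geo] D_pos[of n] by simp
  qed
qed

end
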